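(* Let $m$ be a positive integer with prime factorization $m=p_1^{k_1}\cdots p_h^{k_h}$, let $S\colon\mathbb{Z}_m^{(\mathbb{Z})}\to\mathbb{Z}_m^{(\mathbb{Z})}$ be a finitary linear cellular automaton and let $S=S^{(1)}\times\cdots\times S^{(h)}$ be the primary factorization of $S$. Then the following conditions are equivalent: (1) $S$ is surjective; (2) $S$ is bijective (i.e., $S$ is a group automorphism); (3) $S$ is bijective and its inverse is again a finitary linear cellular automaton; (4) all primary components $S^{(j)}$, $j\in\{1,\ldots,h\}$, satisfy $|\mathrm{supp}^*(S^{(j)})|=1$.
   Context: For a positive integer $q$, $\mathbb{Z}_q=\mathbb{Z}/q\mathbb{Z}$ and $\mathbb{Z}_q^{(\mathbb{Z})}$ is the abelian group of finitely supported sequences $x=(x_n)_{n\in\mathbb{Z}}$ in $\mathbb{Z}_q$. A (one-dimensional) finitary linear cellular automaton on $\mathbb{Z}_q$ is a map $S_\lambda\colon\mathbb{Z}_q^{(\mathbb{Z})}\to\mathbb{Z}_q^{(\mathbb{Z})}$ of the form $(S_\lambda(x))_n=\sum_{i\in\mathbb{Z}}\lambda_ix_{n+i}$ for all $n\in\mathbb{Z}$, for some (unique) $\lambda\in\mathbb{Z}_q^{(\mathbb{Z})}$. Its reduced support is $\mathrm{supp}^*(S_\lambda)=\{i\in\mathbb{Z}:\gcd(\lambda_i,q)=1\}$. Primary factorization: for $m=p_1^{k_1}\cdots p_h^{k_h}$, let $L_i=\mathbb{Z}_{p_i^{k_i}}^{(\mathbb{Z})}$, and identify $\mathbb{Z}_m^{(\mathbb{Z})}$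 with $L_1\times\cdots\times L_h$ coordinatewise via the Chinese remainder isomorphism $\mathbb{Z}_m\cong\prod_i\mathbb{Z}_{p_i^{k_i}}$, $1\mapsto(1,\ldots,1)$. For a finitary linear cellular automaton $S$ on $\mathbb{Z}_m$, the $i$-th primary component is $S^{(i)}=S\restriction_{L_i}\colon L_i\to L_i$; it is a finitary linear cellular automaton on $\mathbb{Z}_{p_i^{k_i}}$ (if $S=S_\lambda$, then $S^{(i)}=S_{\bar\lambda^{(i)}}$ with $\bar\lambda^{(i)}$ the reduction of $\lambda$ modulo $p_i^{k_i}$), and $S=S^{(1)}\times\cdots\times S^{(h)}$. *)

theory Defs
  imports
    "HOL-Algebra.Elementary_Groups"
    "HOL-Algebra.Product_Groups"
    "HOL-Number_Theory.Cong"
    "HOL-Computational_Algebra.Primes"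
begin

text \<open>
  Residue classes modulo \<open>q\<close> are represented by their representatives in \<open>{0..<int q}\<close>,
  as in \<^const>\<open>integer_mod_group\<close>. The finitely supported bi-infinite sequences are the
  direct sum of copies of that group; as the index set is \<^term>\<open>UNIV :: int set\<close>, the
  carrier consists of plain functions (see \<open>mem_fin_seq_group\<close> below).
\<close>

definition fin_seq_group :: "nat \<Rightarrow> (int \<Rightarrow> int) monoid" where
  "fin_seq_group q = sum_group UNIV (\<lambda>_. integer_mod_group q)"

abbreviation fin_seqs :: "nat \<Rightarrow> (int \<Rightarrow> int) set" where
  "fin_seqs q \<equiv> carrier (fin_seq_group q)"

definition linear_ca_map :: "nat \<Rightarrow> (int \<Rightarrow> int) \<Rightarrow> (int \<Rightarrow> int) \<Rightarrow> int \<Rightarrow> int" where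
  "linear_ca_map q l x = (\<lambda>n. (\<Sum>i | l i \<noteq> 0. l i * x (n + i)) mod int q)"

text \<open>
  Maps between sequence groups are HOL functions of which only the values on the carrier
  matter.
\<close>

definition is_rule :: "nat \<Rightarrow> ((int \<Rightarrow> int) \<Rightarrow> int \<Rightarrow> int) \<Rightarrow> (int \<Rightarrow> int) \<Rightarrow> bool" where
  "is_rule q S l \<longleftrightarrow> l \<in> fin_seqs q \<and> (\<forall>x\<in>fin_seqs q. S x = linear_ca_map q l x)"

definition finitary_linear_ca :: "nat \<Rightarrow> ((int \<Rightarrow> int) \<Rightarrow> int \<Rightarrow> int) \<Rightarrow> bool" where
  "finitary_linear_ca q S \<longleftrightarrow> (\<exists>l. is_rule q S l)"

text \<open>The description is legitimate for \<open>q > 0\<close> by \<open>is_rule_unique\<close> below.\<close>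

definition reduced_support :: "nat \<Rightarrow> ((int \<Rightarrow> int) \<Rightarrow> int \<Rightarrow> int) \<Rightarrow> int set" where
  "reduced_support q S = {i. gcd ((THE l. is_rule q S l) i) (int q) = 1}"

text \<open>
  Since the prime factors of \<open>m\<close> are pairwise distinct, the primary components are indexed
  by these primes instead of by \<open>1, \<dots>, h\<close>.
\<close>

definition primary_modulus :: "nat \<Rightarrow> nat \<Rightarrow> nat" where
  "primary_modulus m p = p ^ multiplicity p m"

definition reduce_seq :: "nat \<Rightarrow> (int \<Rightarrow> int) \<Rightarrow> int \<Rightarrow> int" where
  "reduce_seq q x = (\<lambda>n. x n mod int q)"

definition primary_product :: "nat \<Rightarrow> (nat \<Rightarrow> int \<Rightarrow> int) monoid" where
  "primary_product m =
     product_group (prime_factors m) (\<lambda>p. fin_seq_group (primary_modulus m p))"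

text \<open>The coordinatewise Chinese remainder identification.\<close>

definition crt_iso :: "nat \<Rightarrow> (int \<Rightarrow> int) \<Rightarrow> nat \<Rightarrow> int \<Rightarrow> int" where
  "crt_iso m x = (\<lambda>p\<in>prime_factors m. reduce_seq (primary_modulus m p) x)"

text \<open>
  The embedding of the factor at \<open>p\<close>: \<open>primary_incl m p y\<close> is the sequence modulo \<open>m\<close>
  which is identified with the tuple having \<open>y\<close> at \<open>p\<close> and zero elsewhere.
\<close>

definition primary_incl :: "nat \<Rightarrow> nat \<Rightarrow> (int \<Rightarrow> int) \<Rightarrow> int \<Rightarrow> int" where
  "primary_incl m p y =
     inv_into (fin_seqs m) (crt_iso m)
       (\<lambda>r\<in>prime_factors m. if r = p then y else \<one>\<^bsub>fin_seq_group (primary_modulus m r)\<^esub>)"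

text \<open>
  The restriction of \<open>S\<close> to the factor at \<open>p\<close>, read as a self-map of that factor. Taking the
  \<open>p\<close>-coordinate of the value loses nothing, by \<open>primary_component_restriction\<close> below.
\<close>

definition primary_component ::
    "nat \<Rightarrow> nat \<Rightarrow> ((int \<Rightarrow> int) \<Rightarrow> int \<Rightarrow> int) \<Rightarrow> (int \<Rightarrow> int) \<Rightarrow> int \<Rightarrow> int" where
  "primary_component m p S y = crt_iso m (S (primary_incl m p y)) p"


lemma mem_fin_seq_group:
  assumes "q > 0"
  shows "x \<in> fin_seqs q \<longleftrightarrow> (\<forall>n. 0 \<le> x n \<and> x n < int q) \<and> finite {n. x n \<noteq> 0}"
  using assms
  by (auto simp: fin_seq_group_def carrier_sum_group carrier_integer_mod_group PiE_iff)

lemma one_fin_seq_group: "\<one>\<^bsub>fin_seq_group q\<^esub> = (\<lambda>_. 0)"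
  by (simp add: fin_seq_group_def restrict_UNIV)

lemma mult_fin_seq_group:
  "x \<otimes>\<^bsub>fin_seq_group q\<^esub> y = (\<lambda>n. (x n + y n) mod int q)"
  by (simp add: fin_seq_group_def restrict_UNIV)

lemma group_fin_seq_group: "group (fin_seq_group q)"
  by (simp add: fin_seq_group_def)

lemma linear_ca_map_eq:
  assumes "finite A" "{i. l i \<noteq> 0} \<subseteq> A"
  shows "linear_ca_map q l x n = (\<Sum>i\<in>A. l i * x (n + i)) mod int q"
proof -
  have "(\<Sum>i | l i \<noteq> 0. l i * x (n + i)) = (\<Sum>i\<in>A. l i * x (n + i))"
    by (rule sum.mono_neutral_left) (use assms in auto)
  then show ?thesis by (simp add: linear_ca_map_def)
qed

lemma linear_ca_map_closed:
  assumes q: "q > 0" and l: "l \<in> fin_seqs q" and x: "x \<in> fin_seqs q"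
  shows "linear_ca_map q l x \<in> fin_seqs q"
proof -
  let ?L = "{i. l i \<noteq> 0}" and ?X = "{n. x n \<noteq> 0}"
  have fin: "finite ?L" "finite ?X" using l x q by (auto simp: mem_fin_seq_group)
  have "{n. linear_ca_map q l x n \<noteq> 0} \<subseteq> (\<lambda>(n, i). n - i) ` (?X \<times> ?L)"
  proof
    fix n assume "n \<in> {n. linear_ca_map q l x n \<noteq> 0}"
    then have "(\<Sum>i | l i \<noteq> 0. l i * x (n + i)) \<noteq> 0" by (auto simp: linear_ca_map_def)
    then obtain i where "l i \<noteq> 0" "l i * x (n + i) \<noteq> 0"
      by (metis (mono_tags, lifting) mem_Collect_eq sum.neutral)
    then have "(n + i, i) \<in> ?X \<times> ?L" "n = (\<lambda>(n, i). n - i) (n + i, i)" by auto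
    then show "n \<in> (\<lambda>(n, i). n - i) ` (?X \<times> ?L)" by blast
  qed
  then have "finite {n. linear_ca_map q l x n \<noteq> 0}"
    using fin by (meson finite_SigmaI finite_imageI finite_subset)
  then show ?thesis using q by (auto simp: mem_fin_seq_group linear_ca_map_def)
qed

lemma is_rule_unique:
  assumes q: "q > 0" and "is_rule q S l" "is_rule q S l'"
  shows "l = l'"
proof (cases "q = 1")
  case True
  have "a = (\<lambda>_. 0)" if "a \<in> fin_seqs q" for a
  proof
    fix n
    have "0 \<le> a n" "a n < int q" using that q by (simp_all add: mem_fin_seq_group)
    then show "a n = 0" using True by simp
  qed
  then show ?thesis using assms unfolding is_rule_def by blast
next
  case False
  define d :: "int \<Rightarrow> int" where "d = (\<lambda>n. if n = 0 then 1 else 0)"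
  have d: "d \<in> fin_seqs q" using q False by (auto simp: mem_fin_seq_group d_def)
  have "linear_ca_map q a d (- j) = a j" if a: "a \<in> fin_seqs q" for a j
  proof -
    have "linear_ca_map q a d (- j) = (\<Sum>i\<in>insert j {i. a i \<noteq> 0}. a i * d (- j + i)) mod int q"
      by (rule linear_ca_map_eq) (use a q in \<open>auto simp: mem_fin_seq_group\<close>)
    also have "(\<Sum>i\<in>insert j {i. a i \<noteq> 0}. a i * d (- j + i)) =
        (\<Sum>i\<in>{j}. a i * d (- j + i))"
      by (rule sum.mono_neutral_right) (use a q in \<open>auto simp: mem_fin_seq_group d_def\<close>)
    finally show ?thesis using a q by (simp add: d_def mem_fin_seq_group)
  qed
  then show ?thesis using assms d by (metis ext is_rule_def)
qed

lemma reduced_support_eq: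
  assumes "q > 0" "is_rule q S l"
  shows "reduced_support q S = {i. gcd (l i) (int q) = 1}"
  using assms is_rule_unique[OF assms(1)]
  by (auto simp: reduced_support_def the_equality[of "is_rule q S" l])

lemma finitary_linear_ca_hom:
  assumes "q > 0" "finitary_linear_ca q S"
  shows "S \<in> hom (fin_seq_group q) (fin_seq_group q)"
proof -
  obtain l where l: "l \<in> fin_seqs q" "\<And>x. x \<in> fin_seqs q \<Longrightarrow> S x = linear_ca_map q l x"
    using assms by (auto simp: finitary_linear_ca_def is_rule_def)
  have add: "linear_ca_map q l (x \<otimes>\<^bsub>fin_seq_group q\<^esub> y) =
      linear_ca_map q l x \<otimes>\<^bsub>fin_seq_group q\<^esub> linear_ca_map q l y" for x y
  proof
    fix n
    have "(\<Sum>i | l i \<noteq> 0. l i * ((x (n + i) + y (n + i)) mod int q)) mod int q =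
        (\<Sum>i | l i \<noteq> 0. l i * (x (n + i) + y (n + i))) mod int q"
      by (subst (1 2) mod_sum_eq[symmetric]) (simp add: mod_mult_right_eq)
    then show "linear_ca_map q l (x \<otimes>\<^bsub>fin_seq_group q\<^esub> y) n =
        (linear_ca_map q l x \<otimes>\<^bsub>fin_seq_group q\<^esub> linear_ca_map q l y) n"
      by (simp add: linear_ca_map_def mult_fin_seq_group distrib_left sum.distrib mod_add_eq)
  qed
  have "x \<otimes>\<^bsub>fin_seq_group q\<^esub> y \<in> fin_seqs q" if "x \<in> fin_seqs q" "y \<in> fin_seqs q" for x y
    using that group_fin_seq_group[of q] by (simp add: group.is_monoid monoid.m_closed)
  then show ?thesis
    using l add linear_ca_map_closed[OF assms(1)] by (auto simp: hom_def Pi_iff)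
qed

text \<open>So a bijective finitary linear cellular automaton is a group automorphism.\<close>

lemma finitary_linear_ca_iso_iff:
  assumes "q > 0" "finitary_linear_ca q S"
  shows "S \<in> iso (fin_seq_group q) (fin_seq_group q) \<longleftrightarrow> bij_betw S (fin_seqs q) (fin_seqs q)"
  using finitary_linear_ca_hom[OF assms] by (auto simp: iso_def)

lemma primary_modulus_pos: "p \<in> prime_factors m \<Longrightarrow> primary_modulus m p > 0"
  by (auto simp: primary_modulus_def prime_factors_gt_0_nat)

lemma primary_modulus_dvd: "primary_modulus m p dvd m"
  by (simp add: primary_modulus_def multiplicity_dvd)

lemma primary_modulus_coprime:
  assumes "p \<in> prime_factors m" "r \<in> prime_factors m" "p \<noteq> r"
  shows "coprime (primary_modulus m p) (primary_modulus m r)"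
  using assms by (auto simp: primary_modulus_def in_prime_factors_iff primes_coprime)

lemma prod_primary_modulus: "m > 0 \<Longrightarrow> (\<Prod>p\<in>prime_factors m. primary_modulus m p) = m"
  using prod_prime_factors[of m] by (simp add: primary_modulus_def)

lemma primary_modulus_crt:
  fixes u :: "nat \<Rightarrow> int"
  assumes m: "m > 0"
    and u: "\<And>p. p \<in> prime_factors m \<Longrightarrow> 0 \<le> u p \<and> u p < int (primary_modulus m p)"
  shows "\<exists>!z. 0 \<le> z \<and> z < int m \<and> (\<forall>p\<in>prime_factors m. z mod int (primary_modulus m p) = u p)"
proof -
  have "\<exists>!x. x < (\<Prod>p\<in>prime_factors m. primary_modulus m p) \<and>
      (\<forall>p\<in>prime_factors m. [x = nat (u p)] (mod primary_modulus m p))"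
    by (rule chinese_remainder_unique_nat)
      (auto simp: primary_modulus_coprime dest: primary_modulus_pos)
  then have ex1: "\<exists>!x. x < m \<and> (\<forall>p\<in>prime_factors m. [x = nat (u p)] (mod primary_modulus m p))"
    by (simp add: prod_primary_modulus[OF m])
  have eq: "[x = nat (u p)] (mod primary_modulus m p) \<longleftrightarrow>
      int x mod int (primary_modulus m p) = u p" if "p \<in> prime_factors m" for x p
    using u[OF that] by (auto simp: cong_def zmod_int[symmetric] nat_less_iff)
  have ex1': "\<exists>!x. x < m \<and> (\<forall>p\<in>prime_factors m. int x mod int (primary_modulus m p) = u p)"
    using ex1 eq by (simp cong: conj_cong ball_cong)
  show ?thesis
  proof -
    let ?Q = "\<lambda>x. x < m \<and> (\<forall>p\<in>prime_factors m. int x mod int (primary_modulus m p) = u p)"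
    obtain x where x: "?Q x" and un: "\<And>y. ?Q y \<Longrightarrow> y = x"
      using ex1' by (rule ex1E) blast
    show ?thesis
    proof (rule ex1I[of _ "int x"])
      show "0 \<le> int x \<and> int x < int m \<and>
          (\<forall>p\<in>prime_factors m. int x mod int (primary_modulus m p) = u p)"
        using x by simp
    next
      fix z assume z: "0 \<le> z \<and> z < int m \<and>
          (\<forall>p\<in>prime_factors m. z mod int (primary_modulus m p) = u p)"
      then have n: "int (nat z) = z" by simp
      then have "nat z = x" by (intro un) (use z in \<open>simp add: nat_less_iff\<close>)
      with n show "z = int x" by (simp only:)
    qed
  qed
qed

lemma reduce_seq_closed:
  assumes "q > 0" "finite {n. x n \<noteq> 0}"
  shows "reduce_seq q x \<in> fin_seqs q"
proof -
  have "{n. reduce_seq q x n \<noteq> 0} \<subseteq> {n. x n \<noteq> 0}" by (auto simp: reduce_seq_def)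
  then show ?thesis
    using assms by (auto simp: mem_fin_seq_group reduce_seq_def intro: finite_subset)
qed

lemma crt_iso_bij:
  assumes m: "m > 0"
  shows "bij_betw (crt_iso m) (fin_seqs m) (carrier (primary_product m))"
  unfolding bij_betw_def
proof (intro conjI equalityI subsetI)
  show "inj_on (crt_iso m) (fin_seqs m)"
  proof (rule inj_onI, rule ext)
    fix x y n assume x: "x \<in> fin_seqs m" and y: "y \<in> fin_seqs m" and eq: "crt_iso m x = crt_iso m y"
    let ?u = "\<lambda>p. y n mod int (primary_modulus m p)"
    have "x n mod int (primary_modulus m p) = ?u p" if "p \<in> prime_factors m" for p
      using fun_cong[OF fun_cong[OF eq, of p], of n] that by (simp add: crt_iso_def reduce_seq_def)
    moreover have "\<exists>!z. 0 \<le> z \<and> z < int m \<and>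
        (\<forall>p\<in>prime_factors m. z mod int (primary_modulus m p) = ?u p)"
      by (rule primary_modulus_crt[OF m]) (auto dest: primary_modulus_pos)
    ultimately show "x n = y n" using x y m unfolding mem_fin_seq_group[OF m] by blast
  qed
next
  fix f assume "f \<in> crt_iso m ` fin_seqs m"
  then show "f \<in> carrier (primary_product m)"
    using m by (auto simp: primary_product_def crt_iso_def mem_fin_seq_group
        intro!: reduce_seq_closed dest: primary_modulus_pos)
next
  fix f assume f: "f \<in> carrier (primary_product m)"
  have fp: "f p \<in> fin_seqs (primary_modulus m p)" if "p \<in> prime_factors m" for p
    using f that by (auto simp: primary_product_def)
  let ?P = "\<lambda>n z. 0 \<le> z \<and> z < int m \<and>
      (\<forall>p\<in>prime_factors m. z mod int (primary_modulus m p) = f p n)"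
  have ex1: "\<exists>!z. ?P n z" for n
    by (rule primary_modulus_crt[OF m])
      (use fp primary_modulus_pos in \<open>auto simp: mem_fin_seq_group\<close>)
  define x where "x n = (THE z. ?P n z)" for n
  have x: "?P n (x n)" for n
    unfolding x_def by (rule theI'[OF ex1])
  have "{n. x n \<noteq> 0} \<subseteq> (\<Union>p\<in>prime_factors m. {n. f p n \<noteq> 0})"
  proof (rule subsetI, rule ccontr)
    fix n assume n: "n \<in> {n. x n \<noteq> 0}" "n \<notin> (\<Union>p\<in>prime_factors m. {n. f p n \<noteq> 0})"
    then have "?P n 0" using m by auto
    then have "x n = 0" using x ex1[of n] by blast
    then show False using n by simp
  qed
  moreover have "finite (\<Union>p\<in>prime_factors m. {n. f p n \<noteq> 0})"
    using fp primary_modulus_pos by (auto simp: mem_fin_seq_group)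
  ultimately have "finite {n. x n \<noteq> 0}" by (rule finite_subset)
  then have "x \<in> fin_seqs m" using x m by (simp add: mem_fin_seq_group)
  moreover have "crt_iso m x = f"
  proof
    fix p show "crt_iso m x p = f p"
    proof (cases "p \<in> prime_factors m")
      case True
      then have "reduce_seq (primary_modulus m p) x = f p"
        unfolding reduce_seq_def using x by blast
      then show ?thesis using True by (simp add: crt_iso_def)
    next
      case False
      have "f p = undefined"
        using f unfolding primary_product_def carrier_product_group by (rule PiE_arb[OF _ False])
      then show ?thesis using False by (simp only: crt_iso_def restrict_apply if_False)
    qed
  qed
  ultimately show "f \<in> crt_iso m ` fin_seqs m" by blast
qed

lemma crt_iso_iso:
  assumes m: "m > 0"
  shows "crt_iso m \<in> iso (fin_seq_group m) (primary_product m)"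
proof -
  have "crt_iso m (x \<otimes>\<^bsub>fin_seq_group m\<^esub> y) =
      crt_iso m x \<otimes>\<^bsub>primary_product m\<^esub> crt_iso m y" for x y
    by (rule ext) (simp add: crt_iso_def primary_product_def mult_fin_seq_group reduce_seq_def
        mod_add_eq mod_mod_cancel primary_modulus_dvd)
  then show ?thesis
    using crt_iso_bij[OF m] by (auto simp: iso_def hom_def bij_betw_def)
qed

lemma primary_incl:
  assumes m: "m > 0" and p: "p \<in> prime_factors m" and y: "y \<in> fin_seqs (primary_modulus m p)"
  shows "primary_incl m p y \<in> fin_seqs m"
    and "crt_iso m (primary_incl m p y) =
      (\<lambda>r\<in>prime_factors m. if r = p then y else \<one>\<^bsub>fin_seq_group (primary_modulus m r)\<^esub>)"
proof -
  let ?f = "\<lambda>r\<in>prime_factors m. if r = p then y else \<one>\<^bsub>fin_seq_group (primary_modulus m r)\<^esub>"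
  have "?f \<in> carrier (primary_product m)"
    using y group_fin_seq_group by (auto simp: primary_product_def group.is_monoid)
  then have f: "?f \<in> crt_iso m ` fin_seqs m" using crt_iso_bij[OF m] by (simp add: bij_betw_def)
  show "primary_incl m p y \<in> fin_seqs m"
    unfolding primary_incl_def by (rule inv_into_into[OF f])
  show "crt_iso m (primary_incl m p y) = ?f"
    unfolding primary_incl_def by (rule f_inv_into_f[OF f])
qed

lemma crt_iso_linear_ca_map:
  assumes m: "m > 0" and l: "l \<in> fin_seqs m" and p: "p \<in> prime_factors m"
  shows "crt_iso m (linear_ca_map m l x) p =
    linear_ca_map (primary_modulus m p) (reduce_seq (primary_modulus m p) l) (crt_iso m x p)"
proof
  fix n
  let ?q = "primary_modulus m p"
  let ?A = "{i. l i \<noteq> 0}"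
  have fin: "finite ?A" using l by (simp add: mem_fin_seq_group[OF m])
  have c: "crt_iso m z p = reduce_seq ?q z" for z
    unfolding crt_iso_def by (rule restrict_apply'[OF p])
  have "linear_ca_map ?q (reduce_seq ?q l) (reduce_seq ?q x) n =
      (\<Sum>i\<in>?A. reduce_seq ?q l i * reduce_seq ?q x (n + i)) mod int ?q"
    by (rule linear_ca_map_eq[OF fin]) (auto simp: reduce_seq_def)
  also have "\<dots> = (\<Sum>i\<in>?A. (reduce_seq ?q l i * reduce_seq ?q x (n + i)) mod int ?q) mod int ?q"
    by (rule mod_sum_eq[symmetric])
  also have "\<dots> = (\<Sum>i\<in>?A. (l i * x (n + i)) mod int ?q) mod int ?q"
    by (simp only: reduce_seq_def mod_mult_eq)
  also have "\<dots> = (\<Sum>i\<in>?A. l i * x (n + i)) mod int ?q"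
    by (rule mod_sum_eq)
  also have "\<dots> = reduce_seq ?q (linear_ca_map m l x) n"
    unfolding reduce_seq_def linear_ca_map_def
    by (rule mod_mod_cancel[symmetric]) (simp only: int_dvd_int_iff primary_modulus_dvd)
  finally show "crt_iso m (linear_ca_map m l x) p n =
      linear_ca_map ?q (reduce_seq ?q l) (crt_iso m x p) n"
    unfolding c by (rule sym)
qed

lemma primary_component_rule:
  assumes m: "m > 0" and S: "is_rule m S l" and p: "p \<in> prime_factors m"
  shows "is_rule (primary_modulus m p) (primary_component m p S) (reduce_seq (primary_modulus m p) l)"
  unfolding is_rule_def
proof (intro conjI ballI)
  have l: "l \<in> fin_seqs m" using S by (simp add: is_rule_def)
  then show "reduce_seq (primary_modulus m p) l \<in> fin_seqs (primary_modulus m p)"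
    using m p by (auto simp: mem_fin_seq_group intro!: reduce_seq_closed dest: primary_modulus_pos)
  fix y assume y: "y \<in> fin_seqs (primary_modulus m p)"
  have "S (primary_incl m p y) = linear_ca_map m l (primary_incl m p y)"
    using S primary_incl(1)[OF m p y] by (simp add: is_rule_def)
  then show "primary_component m p S y =
      linear_ca_map (primary_modulus m p) (reduce_seq (primary_modulus m p) l) y"
    using primary_incl(2)[OF m p y] p
    by (simp add: primary_component_def crt_iso_linear_ca_map[OF m l p])
qed

lemma primary_component_restriction:
  assumes m: "m > 0" and S: "finitary_linear_ca m S" and p: "p \<in> prime_factors m"
    and y: "y \<in> fin_seqs (primary_modulus m p)"
  shows "S (primary_incl m p y) = primary_incl m p (primary_component m p S y)"
proof -
  obtain l where S: "is_rule m S l" using S by (auto simp: finitary_linear_ca_def)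
  then have l: "l \<in> fin_seqs m" by (simp add: is_rule_def)
  have i: "primary_incl m p y \<in> fin_seqs m" by (rule primary_incl(1)[OF m p y])
  have Si: "S (primary_incl m p y) = linear_ca_map m l (primary_incl m p y)"
    using S i by (simp add: is_rule_def)
  have r: "is_rule (primary_modulus m p) (primary_component m p S) (reduce_seq (primary_modulus m p) l)"
    by (rule primary_component_rule[OF m S p])
  then have cl: "primary_component m p S y \<in> fin_seqs (primary_modulus m p)"
    using linear_ca_map_closed[OF primary_modulus_pos[OF p] _ y] y by (auto simp: is_rule_def)
  have "crt_iso m (S (primary_incl m p y)) = crt_iso m (primary_incl m p (primary_component m p S y))"
  proof
    fix r
    show "crt_iso m (S (primary_incl m p y)) r =
        crt_iso m (primary_incl m p (primary_component m p S y)) r"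
    proof (cases "r \<in> prime_factors m \<and> r \<noteq> p")
      case True
      then have "crt_iso m (primary_incl m p y) r = (\<lambda>_. 0)"
        using primary_incl(2)[OF m p y] by (simp add: one_fin_seq_group)
      then have "crt_iso m (S (primary_incl m p y)) r = (\<lambda>_. 0)"
        using True by (simp add: Si crt_iso_linear_ca_map[OF m l]) (simp add: linear_ca_map_def)
      then show ?thesis using True primary_incl(2)[OF m p cl] by (simp add: one_fin_seq_group)
    next
      case False
      then show ?thesis
        using primary_incl(2)[OF m p cl] p
        by (cases "r = p") (simp_all add: primary_component_def, simp add: crt_iso_def)
    qed
  qed
  moreover have "S (primary_incl m p y) \<in> fin_seqs m"
    using Si linear_ca_map_closed[OF m l i] by simp
  ultimately show ?thesis
    using crt_iso_bij[OF m] primary_incl(1)[OF m p cl] by (auto simp: bij_betw_def dest: inj_onD)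
qed

text \<open>Under the identification, \<open>S\<close> is the product of its primary components.\<close>

lemma primary_factorization:
  assumes m: "m > 0" and S: "finitary_linear_ca m S" and x: "x \<in> fin_seqs m"
  shows "crt_iso m (S x) = (\<lambda>p\<in>prime_factors m. primary_component m p S (crt_iso m x p))"
proof
  fix p
  obtain l where S: "is_rule m S l" using S by (auto simp: finitary_linear_ca_def)
  then have l: "l \<in> fin_seqs m" by (simp add: is_rule_def)
  show "crt_iso m (S x) p = (\<lambda>p\<in>prime_factors m. primary_component m p S (crt_iso m x p)) p"
  proof (cases "p \<in> prime_factors m")
    case p: True
    have "crt_iso m x \<in> carrier (primary_product m)"
      using crt_iso_bij[OF m] x by (auto simp: bij_betw_def)
    then have "crt_iso m x p \<in> fin_seqs (primary_modulus m p)"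
      using p by (auto simp: primary_product_def)
    then show ?thesis
      using S x p primary_component_rule[OF m S p] by (simp add: is_rule_def crt_iso_linear_ca_map[OF m l p])
  qed (simp add: crt_iso_def)
qed

end

theory Submission
  imports Defs "HOL-Library.Poly_Mapping"
begin

text \<open>
  Finitely supported functions from the integers to the integers form, under convolution, the
  ring of Laurent polynomials over the integers; it is the type \<^typ>\<open>int \<Rightarrow>\<^sub>0 int\<close>. Reading
  sequences modulo \<open>m\<close> as Laurent polynomials with coefficients modulo \<open>m\<close>, the automaton with
  rule \<open>l\<close> is multiplication by the Laurent polynomial \<open>L\<close> whose coefficient at \<open>i\<close> is
  \<open>l (- i)\<close> (lemma \<open>linear_ca_map_reduce\<close>). If the automaton is surjective, then \<open>1\<close> has a
  preimage, so \<open>L\<close> is invertible modulo \<open>m\<close>; and if \<open>L\<close> has an inverse \<open>M\<close> modulo \<open>m\<close>, then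
  multiplication by \<open>M\<close> is an automaton inverse to the given one. So the first three conditions
  all say that \<open>L\<close> is invertible modulo \<open>m\<close>.

  It remains to see that \<open>L\<close> is invertible modulo \<open>m\<close> if and only if, for each prime \<open>p\<close> dividing
  \<open>m\<close>, exactly one coefficient of \<open>L\<close> is prime to \<open>p\<close> (lemma \<open>laurent_invertible_mod_iff\<close>). Over
  the field with \<open>p\<close> elements, the top and the bottom degree of a product are the sums of those
  of the factors, so the factors of \<open>1\<close> are monomials: this is necessity. Conversely,
  a Laurent polynomial that is a monomial modulo \<open>p\<close> is invertible modulo \<open>p\<close>, and in any
  commutative ring invertibility modulo \<open>a\<close> and modulo \<open>b\<close> implies invertibility modulo \<open>a * b\<close>
  (lemma \<open>invertible_mod_mult\<close>). As \<open>a\<close> and \<open>b\<close> may share factors, it covers at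
  once the passage from \<open>p\<close> to its powers and from prime powers to \<open>m\<close>.
\<close>

section \<open>Laurent polynomials over the integers\<close>

abbreviation lookup :: "(int \<Rightarrow>\<^sub>0 int) \<Rightarrow> int \<Rightarrow> int" where
  "lookup \<equiv> Poly_Mapping.lookup"

lemma lookup_mult_int:
  fixes f g :: "int \<Rightarrow>\<^sub>0 int"
  assumes "finite A" "Poly_Mapping.keys f \<subseteq> A"
  shows "lookup (f * g) n = (\<Sum>i\<in>A. lookup f i * lookup g (n - i))"
proof -
  have inner: "(\<Sum>q. lookup g q when n = i + q) = lookup g (n - i)" for i
  proof -
    have "(\<lambda>q. lookup g q when n = i + q) = (\<lambda>q. lookup g q when q = n - i)"
      by (auto simp: when_def)
    then show ?thesis by (simp only: Sum_any_when_equal)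
  qed
  have "lookup (f * g) n = (\<Sum>i. lookup f i * lookup g (n - i))"
    by (simp add: lookup_mult inner)
  also have "\<dots> = (\<Sum>i\<in>A. lookup f i * lookup g (n - i))"
    by (rule Sum_any.expand_superset) (use assms in \<open>auto simp: in_keys_iff\<close>)
  finally show ?thesis .
qed

lemma lookup_of_nat_times:
  fixes f :: "int \<Rightarrow>\<^sub>0 int"
  shows "lookup (of_nat q * f) n = int q * lookup f n"
  by (induction q) (simp_all add: distrib_right lookup_add)

text \<open>
  Keeping the coefficients integral, and reading congruence modulo \<open>q\<close> as divisibility by
  \<^term>\<open>of_nat q\<close>, lets a single ring serve for \<open>m\<close> and for all its prime divisors.
\<close>

lemma of_nat_dvd_iff_coeffs:
  fixes f :: "int \<Rightarrow>\<^sub>0 int"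
  shows "of_nat q dvd f \<longleftrightarrow> (\<forall>n. int q dvd lookup f n)"
proof
  assume "of_nat q dvd f"
  then show "\<forall>n. int q dvd lookup f n"
    by (auto simp: lookup_of_nat_times)
next
  assume d: "\<forall>n. int q dvd lookup f n"
  have "{n. lookup f n div int q \<noteq> 0} \<subseteq> Poly_Mapping.keys f"
    by (auto simp: in_keys_iff)
  then have "finite {n. lookup f n div int q \<noteq> 0}"
    by (rule finite_subset) simp
  then have "f = of_nat q * Abs_poly_mapping (\<lambda>n. lookup f n div int q)"
    using d by (intro poly_mapping_eqI) (simp add: lookup_of_nat_times)
  then show "of_nat q dvd f" by (rule dvdI)
qed

lemma reduce_seq_lookup_eq_iff:
  fixes f g :: "int \<Rightarrow>\<^sub>0 int"
  shows "reduce_seq q (lookup f) = reduce_seq q (lookup g) \<longleftrightarrow> of_nat q dvd f - g"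
  by (simp add: reduce_seq_def fun_eq_iff of_nat_dvd_iff_coeffs lookup_minus mod_eq_dvd_iff)

section \<open>Invertibility modulo an integer\<close>

text \<open>
  The reason is the identity \<open>1 - u * z = (1 - u * v) * (1 - u * w)\<close> for
  \<open>z = v + w - u * v * w\<close>.
\<close>

lemma invertible_mod_mult:
  fixes a b u :: "'a::comm_ring_1"
  assumes "\<exists>v. a dvd u * v - 1" "\<exists>w. b dvd u * w - 1"
  shows "\<exists>z. a * b dvd u * z - 1"
proof -
  obtain v w where "a dvd u * v - 1" "b dvd u * w - 1" using assms by blast
  then have "a * b dvd - ((u * v - 1) * (u * w - 1))"
    by (simp add: mult_dvd_mono)
  also have "- ((u * v - 1) * (u * w - 1)) = u * (v + w - u * v * w) - 1"
    by (simp add: algebra_simps)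
  finally show ?thesis by blast
qed

lemma invertible_mod_of_primes:
  fixes u :: "'a::comm_ring_1"
  assumes "m > 0" "\<forall>p\<in>prime_factors m. \<exists>v. of_nat p dvd u * v - 1"
  shows "\<exists>v. of_nat m dvd u * v - 1"
  using assms
proof (induction m rule: prime_divisors_induct)
  case zero
  then show ?case by simp
next
  case (unit x)
  then show ?case by simp
next
  case (factor p x)
  have x: "x > 0" using factor by simp
  have "prime_factors x \<subseteq> prime_factors (p * x)" "p \<in> prime_factors (p * x)"
    using factor x by (auto simp: in_prime_factors_iff)
  then have "\<exists>v. of_nat p dvd u * v - 1" "\<exists>v. of_nat x dvd u * v - 1"
    using factor x by blast+
  then show ?case
    unfolding of_nat_mult by (rule invertible_mod_mult)
qed

text \<open>
  Since \<open>f\<close> and \<open>g\<close> may have several coefficients prime to \<open>p\<close>, terms of the convolution sum can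
  cancel modulo \<open>p\<close>. They cannot at an exponent that is in only one way a sum of an exponent
  of \<open>f\<close> and one of \<open>g\<close> with such coefficients; the sum of the two largest exponents is of
  this kind, and so is that of the two smallest.
\<close>

lemma coeff_mult_unique_sum:
  fixes f g :: "int \<Rightarrow>\<^sub>0 int"
  assumes p: "prime p"
    and ab: "\<not> int p dvd lookup f a" "\<not> int p dvd lookup g b"
    and unique: "\<And>i j. \<not> int p dvd lookup f i \<Longrightarrow> \<not> int p dvd lookup g j \<Longrightarrow> i + j = a + b \<Longrightarrow> i = a"
  shows "\<not> int p dvd lookup (f * g) (a + b)"
proof
  assume d: "int p dvd lookup (f * g) (a + b)"
  let ?A = "insert a (Poly_Mapping.keys f)"
  have "lookup (f * g) (a + b) = (\<Sum>i\<in>?A. lookup f i * lookup g (a + b - i))"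
    by (rule lookup_mult_int) auto
  also have "\<dots> = lookup f a * lookup g b +
      (\<Sum>i\<in>Poly_Mapping.keys f - {a}. lookup f i * lookup g (a + b - i))"
    by (subst sum.insert_remove) auto
  finally have eq: "lookup (f * g) (a + b) = \<dots>" .
  have "int p dvd (\<Sum>i\<in>Poly_Mapping.keys f - {a}. lookup f i * lookup g (a + b - i))"
  proof (rule dvd_sum)
    fix i assume i: "i \<in> Poly_Mapping.keys f - {a}"
    show "int p dvd lookup f i * lookup g (a + b - i)"
      using unique[of i "a + b - i"] i by (auto intro: dvd_mult dvd_mult2)
  qed
  then have "int p dvd lookup f a * lookup g b"
    using d unfolding eq by (simp add: dvd_add_left_iff)
  then show False
    using ab p by (simp add: prime_dvd_mult_iff)
qed

lemma laurent_invertible_mod_prime: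
  fixes f g :: "int \<Rightarrow>\<^sub>0 int"
  assumes p: "prime p" and fg: "of_nat p dvd f * g - 1"
  shows "card {i. \<not> int p dvd lookup f i} = 1"
proof -
  let ?A = "\<lambda>h :: int \<Rightarrow>\<^sub>0 int. {i. \<not> int p dvd lookup h i}"
  have fin: "finite (?A h)" for h
    by (rule finite_subset[of _ "Poly_Mapping.keys h"]) (auto simp: in_keys_iff)
  have coeff: "int p dvd lookup (f * g) n - (if n = 0 then 1 else 0)" for n
    using fg by (auto simp: of_nat_dvd_iff_coeffs lookup_minus lookup_one when_def split: if_splits)
  have zero: "n = 0" if "\<not> int p dvd lookup (f * g) n" for n
    using coeff[of n] that by (auto split: if_splits)
  have "\<not> int p dvd lookup (f * g) 0"
  proof
    assume "int p dvd lookup (f * g) 0"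
    then have "int p dvd 1" using coeff[of 0] by (simp add: dvd_diff_right_iff)
    then show False using p by auto
  qed
  then have "\<exists>i\<in>Poly_Mapping.keys f. \<not> int p dvd lookup f i * lookup g (0 - i)"
    unfolding lookup_mult_int[OF finite_keys order_refl] by (meson dvd_sum)
  then have ne: "?A f \<noteq> {}" "?A g \<noteq> {}"
    by (auto intro: dvd_mult dvd_mult2)
  have bounds: "Min (?A h) \<le> i \<and> i \<le> Max (?A h)" if "\<not> int p dvd lookup h i" for h i
    using that by (intro conjI Min_le Max_ge fin) simp_all
  have extreme: "\<not> int p dvd lookup h (Max (?A h))" "\<not> int p dvd lookup h (Min (?A h))"
    if "?A h \<noteq> {}" for h
    using CollectD[OF Max_in[OF fin that]] CollectD[OF Min_in[OF fin that]] .
  \<comment> \<open>The product is \<open>1\<close> modulo \<open>p\<close>, so the sum of the top degrees and that of the bottom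
    degrees are both \<open>0\<close>; this leaves no room between top and bottom in either factor.\<close>
  have "\<not> int p dvd lookup (f * g) (Max (?A f) + Max (?A g))"
  proof (rule coeff_mult_unique_sum[OF p extreme(1)[OF ne(1)] extreme(1)[OF ne(2)]])
    fix i j assume "\<not> int p dvd lookup f i" "\<not> int p dvd lookup g j"
      and "i + j = Max (?A f) + Max (?A g)"
    then show "i = Max (?A f)" using bounds[of f i] bounds[of g j] by linarith
  qed
  moreover have "\<not> int p dvd lookup (f * g) (Min (?A f) + Min (?A g))"
  proof (rule coeff_mult_unique_sum[OF p extreme(2)[OF ne(1)] extreme(2)[OF ne(2)]])
    fix i j assume "\<not> int p dvd lookup f i" "\<not> int p dvd lookup g j"
      and "i + j = Min (?A f) + Min (?A g)"
    then show "i = Min (?A f)" using bounds[of f i] bounds[of g j] by linarith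
  qed
  ultimately have "Max (?A f) + Max (?A g) = 0" "Min (?A f) + Min (?A g) = 0"
    using zero by blast+
  moreover have "Min (?A f) \<le> Max (?A f)" "Min (?A g) \<le> Max (?A g)"
    using bounds extreme(1) ne by blast+
  ultimately have "Max (?A f) = Min (?A f)" by linarith
  then have "i = Max (?A f)" if "i \<in> ?A f" for i
    using bounds[of f i] that by simp
  then have "?A f = {Max (?A f)}"
    using ne(1) by blast
  then show ?thesis by (metis card_1_singleton_iff One_nat_def)
qed

text \<open>
  Modulo \<open>p\<close>, such an \<open>f\<close> is a monomial with some exponent \<open>a\<close> and a unit coefficient \<open>u\<close>. The
  monomial with exponent \<open>- a\<close> and coefficient inverse to \<open>u\<close> modulo \<open>p\<close> is its inverse.
\<close>

lemma monomial_mod_prime_invertible: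
  fixes f :: "int \<Rightarrow>\<^sub>0 int"
  assumes p: "prime p" and card: "card {i. \<not> int p dvd lookup f i} = 1"
  shows "\<exists>g. of_nat p dvd f * g - 1"
proof -
  obtain a where a: "{i. \<not> int p dvd lookup f i} = {a}"
    using card by (auto simp: card_1_singleton_iff)
  then have "\<not> int p dvd lookup f a" by blast
  then have "coprime (int p) (lookup f a)"
    using p by (intro prime_imp_coprime) auto
  then obtain v where v: "[lookup f a * v = 1] (mod int p)"
    using cong_solve_coprime_int coprime_commute by blast
  have "lookup (f * Poly_Mapping.single (- a) v) n = lookup f (n + a) * v" for n
    unfolding mult.commute[of f]
    by (subst lookup_mult_int[of "{- a}"]) (auto simp: mult.commute)
  moreover have "int p dvd lookup f (n + a) * v - lookup 1 n" for n
  proof (cases "n = 0")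
    case True
    then show ?thesis using v by (simp add: lookup_one cong_iff_dvd_diff)
  next
    case False
    then have "n + a \<notin> {i. \<not> int p dvd lookup f i}" unfolding a by simp
    then show ?thesis using False by (simp add: lookup_one when_def)
  qed
  ultimately have "of_nat p dvd f * Poly_Mapping.single (- a) v - 1"
    by (simp add: of_nat_dvd_iff_coeffs lookup_minus)
  then show ?thesis by blast
qed

lemma laurent_invertible_mod_iff:
  fixes f :: "int \<Rightarrow>\<^sub>0 int"
  assumes "m > 0"
  shows "(\<exists>g. of_nat m dvd f * g - 1) \<longleftrightarrow>
    (\<forall>p\<in>prime_factors m. card {i. \<not> int p dvd lookup f i} = 1)"
proof
  assume "\<exists>g. of_nat m dvd f * g - 1"
  then obtain g where g: "of_nat m dvd f * g - 1" by blast
  show "\<forall>p\<in>prime_factors m. card {i. \<not> int p dvd lookup f i} = 1"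
  proof
    fix p assume "p \<in> prime_factors m"
    then have p: "prime p" "p dvd m" by auto
    have "(of_nat p :: int \<Rightarrow>\<^sub>0 int) dvd of_nat m"
      using p(2) by auto
    then show "card {i. \<not> int p dvd lookup f i} = 1"
      using g by (intro laurent_invertible_mod_prime[OF p(1)]) (rule dvd_trans)
  qed
next
  assume "\<forall>p\<in>prime_factors m. card {i. \<not> int p dvd lookup f i} = 1"
  then show "\<exists>g. of_nat m dvd f * g - 1"
    using assms
    by (intro invertible_mod_of_primes) (auto intro!: monomial_mod_prime_invertible)
qed

section \<open>Linear cellular automata as multiplications\<close>

text \<open>
  An automaton pairs \<open>l i\<close> with \<open>x (n + i)\<close>, while a convolution pairs the coefficients at
  \<open>i\<close> and \<open>n - i\<close>; hence the reflection.
\<close>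

definition reduced_rule :: "nat \<Rightarrow> (int \<Rightarrow>\<^sub>0 int) \<Rightarrow> int \<Rightarrow> int" where
  "reduced_rule q f = reduce_seq q (\<lambda>i. lookup f (- i))"

lemma Collect_uminus_eq_image:
  fixes P :: "'a::group_add \<Rightarrow> bool"
  shows "{i. P (- i)} = uminus ` {i. P i}"
proof (intro equalityI subsetI)
  fix i assume "i \<in> {i. P (- i)}"
  then have "- (- i) \<in> uminus ` {i. P i}" by (intro imageI) simp
  then show "i \<in> uminus ` {i. P i}" by simp
qed auto

lemma finite_lookup_uminus: "finite {i. lookup f (- i) \<noteq> 0}"
  by (simp add: Collect_uminus_eq_image[of "\<lambda>i. lookup f i \<noteq> 0"])

lemma reduced_rule_closed: "q > 0 \<Longrightarrow> reduced_rule q f \<in> fin_seqs q"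
  unfolding reduced_rule_def by (intro reduce_seq_closed finite_lookup_uminus)

lemma reduce_seq_lookup_closed: "q > 0 \<Longrightarrow> reduce_seq q (lookup f) \<in> fin_seqs q"
  by (intro reduce_seq_closed) simp_all

lemma linear_ca_map_reduce:
  assumes q: "q > 0"
  shows "linear_ca_map q (reduced_rule q f) (reduce_seq q (lookup g)) = reduce_seq q (lookup (f * g))"
proof
  fix n
  let ?A = "uminus ` Poly_Mapping.keys f"
  have A: "{i. lookup f (- i) \<noteq> 0} = ?A"
    unfolding keys.rep_eq by (rule Collect_uminus_eq_image)
  have "linear_ca_map q (reduced_rule q f) (reduce_seq q (lookup g)) n =
      (\<Sum>i\<in>?A. reduced_rule q f i * reduce_seq q (lookup g) (n + i)) mod int q"
  proof (rule linear_ca_map_eq)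
    show "{i. reduced_rule q f i \<noteq> 0} \<subseteq> ?A"
      unfolding A[symmetric] by (auto simp: reduced_rule_def reduce_seq_def)
  qed simp
  also have "\<dots> = (\<Sum>i\<in>?A. lookup f (- i) * lookup g (n + i)) mod int q"
    unfolding reduced_rule_def reduce_seq_def
    by (subst (1 2) mod_sum_eq[symmetric]) (simp only: mod_mult_eq)
  also have "(\<Sum>i\<in>?A. lookup f (- i) * lookup g (n + i)) =
      (\<Sum>i\<in>Poly_Mapping.keys f. lookup f i * lookup g (n - i))"
    by (subst sum.reindex) simp_all
  also have "\<dots> = lookup (f * g) n"
    by (rule lookup_mult_int[symmetric]) auto
  finally show "linear_ca_map q (reduced_rule q f) (reduce_seq q (lookup g)) n =
      reduce_seq q (lookup (f * g)) n"
    by (simp add: reduce_seq_def)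
qed

lemma fin_seqs_eq_reduce:
  assumes "q > 0" "x \<in> fin_seqs q"
  obtains f :: "int \<Rightarrow>\<^sub>0 int" where "x = reduce_seq q (lookup f)"
proof (rule that)
  show "x = reduce_seq q (lookup (Abs_poly_mapping x))"
    using assms by (auto simp: mem_fin_seq_group reduce_seq_def fun_eq_iff)
qed

lemma fin_seqs_eq_reduced_rule:
  assumes q: "q > 0" and l: "l \<in> fin_seqs q"
  obtains f where "l = reduced_rule q f"
proof (rule that)
  have "{i. l (- i) \<noteq> 0} = uminus ` {i. l i \<noteq> 0}"
    by (rule Collect_uminus_eq_image)
  then have "finite {i. l (- i) \<noteq> 0}"
    using assms by (simp add: mem_fin_seq_group)
  then show "l = reduced_rule q (Abs_poly_mapping (\<lambda>i. l (- i)))"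
    using assms by (auto simp: mem_fin_seq_group reduced_rule_def reduce_seq_def fun_eq_iff)
qed

lemma surj_rule_invertible:
  assumes q: "q > 0" and S: "is_rule q S (reduced_rule q f)" and surj: "S ` fin_seqs q = fin_seqs q"
  shows "\<exists>g. of_nat q dvd f * g - 1"
proof -
  have "reduce_seq q (lookup 1) \<in> S ` fin_seqs q"
    using surj reduce_seq_lookup_closed[OF q] by simp
  then obtain x where x: "x \<in> fin_seqs q" "reduce_seq q (lookup 1) = S x" by blast
  obtain g where g: "x = reduce_seq q (lookup g)" using fin_seqs_eq_reduce[OF q x(1)] .
  have "reduce_seq q (lookup (f * g)) = reduce_seq q (lookup 1)"
    using S x by (simp add: is_rule_def g linear_ca_map_reduce[OF q])
  then show ?thesis by (auto simp: reduce_seq_lookup_eq_iff)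
qed

lemma invertible_rule_bij:
  assumes q: "q > 0" and S: "is_rule q S (reduced_rule q f)" and g: "of_nat q dvd f * g - 1"
  shows "bij_betw S (fin_seqs q) (fin_seqs q)"
    and "is_rule q (inv_into (fin_seqs q) S) (reduced_rule q g)"
proof -
  define T where "T = linear_ca_map q (reduced_rule q g)"
  have mult: "reduce_seq q (lookup (f * (g * h))) = reduce_seq q (lookup h)" for h
  proof -
    have "of_nat q dvd (f * g - 1) * h" using g by simp
    then show ?thesis
      unfolding reduce_seq_lookup_eq_iff by (simp add: algebra_simps)
  qed
  have Sv: "S x = linear_ca_map q (reduced_rule q f) x" if "x \<in> fin_seqs q" for x
    using S that by (simp add: is_rule_def)
  have closed: "S x \<in> fin_seqs q" "T x \<in> fin_seqs q" if "x \<in> fin_seqs q" for x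
    using that by (auto simp: Sv T_def intro!: linear_ca_map_closed reduced_rule_closed q)
  have inverse: "S (T x) = x" "T (S x) = x" if x: "x \<in> fin_seqs q" for x
  proof -
    obtain h where h: "x = reduce_seq q (lookup h)" using fin_seqs_eq_reduce[OF q x] .
    show "S (T x) = x"
      using closed(2)[OF x] by (simp add: Sv) (simp add: T_def h linear_ca_map_reduce[OF q] mult)
    show "T (S x) = x"
      using mult[of h]
      by (simp add: Sv[OF x]) (simp add: T_def h linear_ca_map_reduce[OF q] mult.left_commute)
  qed
  show bij: "bij_betw S (fin_seqs q) (fin_seqs q)"
    by (rule bij_betw_byWitness[of _ T]) (use closed inverse in auto)
  have "inv_into (fin_seqs q) S x = T x" if "x \<in> fin_seqs q" for x
    using bij closed(2)[OF that] inverse(1)[OF that]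
    by (auto simp: bij_betw_def intro: inv_into_f_eq)
  then show "is_rule q (inv_into (fin_seqs q) S) (reduced_rule q g)"
    by (simp add: is_rule_def T_def reduced_rule_closed[OF q])
qed

text \<open>
  An integer is prime to a positive power of \<open>p\<close> exactly if \<open>p\<close> does not divide it, so the
  reduced support is, up to reflection, the support of \<open>f\<close> modulo \<open>p\<close>.
\<close>

lemma card_reduced_support_primary_component:
  assumes m: "m > 0" and S: "is_rule m S (reduced_rule m f)" and p: "p \<in> prime_factors m"
  shows "card (reduced_support (primary_modulus m p) (primary_component m p S)) =
    card {i. \<not> int p dvd lookup f i}"
proof -
  let ?q = "primary_modulus m p"
  have pr: "prime p" using p by auto
  have k: "multiplicity p m > 0" using p m by (simp add: prime_factors_multiplicity)
  have "gcd (reduce_seq ?q (reduced_rule m f) i) (int ?q) = 1 \<longleftrightarrow> \<not> int p dvd lookup f (- i)" for i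
  proof -
    have "reduce_seq ?q (reduced_rule m f) i = lookup f (- i) mod int ?q"
      unfolding reduce_seq_def reduced_rule_def
      by (rule mod_mod_cancel) (simp add: primary_modulus_dvd)
    then have "gcd (reduce_seq ?q (reduced_rule m f) i) (int ?q) = 1 \<longleftrightarrow>
        coprime (lookup f (- i)) (int ?q)"
      using primary_modulus_pos[OF p] by (simp add: coprime_iff_gcd_eq_1[symmetric])
    also have "\<dots> \<longleftrightarrow> coprime (int p) (lookup f (- i))"
      using k by (simp add: primary_modulus_def coprime_commute)
    also have "\<dots> \<longleftrightarrow> \<not> int p dvd lookup f (- i)"
      using pr by (auto simp: prime_int_nat_transfer intro: prime_imp_coprime
          dest: coprime_absorb_left)
    finally show ?thesis .
  qed
  then have "reduced_support ?q (primary_component m p S) = uminus ` {i. \<not> int p dvd lookup f i}"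
    unfolding reduced_support_eq[OF primary_modulus_pos[OF p] primary_component_rule[OF m S p]]
    by (simp add: Collect_uminus_eq_image[symmetric])
  then show ?thesis by (simp add: card_image)
qed

theorem theorem4p2:
  fixes m :: nat and S :: "(int \<Rightarrow> int) \<Rightarrow> (int \<Rightarrow> int)"
  assumes "m > 0" and "finitary_linear_ca m S"
  shows "(S ` fin_seqs m = fin_seqs m \<longleftrightarrow> bij_betw S (fin_seqs m) (fin_seqs m)) \<and>
    (bij_betw S (fin_seqs m) (fin_seqs m) \<longleftrightarrow>
      bij_betw S (fin_seqs m) (fin_seqs m) \<and> finitary_linear_ca m (inv_into (fin_seqs m) S)) \<and>
    (bij_betw S (fin_seqs m) (fin_seqs m) \<and> finitary_linear_ca m (inv_into (fin_seqs m) S) \<longleftrightarrow>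
      (\<forall>p\<in>prime_factors m.
        card (reduced_support (primary_modulus m p) (primary_component m p S)) = 1))"
proof -
  obtain l where l: "is_rule m S l" using assms(2) by (auto simp: finitary_linear_ca_def)
  then have "l \<in> fin_seqs m" by (simp add: is_rule_def)
  then obtain f where "l = reduced_rule m f" using fin_seqs_eq_reduced_rule[OF assms(1)] by blast
  with l have S: "is_rule m S (reduced_rule m f)" by simp
  let ?U = "\<exists>g. of_nat m dvd f * g - 1"
  have "S ` fin_seqs m = fin_seqs m \<Longrightarrow> ?U"
    by (rule surj_rule_invertible[OF assms(1) S])
  moreover have "?U \<Longrightarrow> bij_betw S (fin_seqs m) (fin_seqs m)"
    and "?U \<Longrightarrow> finitary_linear_ca m (inv_into (fin_seqs m) S)"
    using invertible_rule_bij[OF assms(1) S] by (auto simp: finitary_linear_ca_def)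
  moreover have "bij_betw S (fin_seqs m) (fin_seqs m) \<Longrightarrow> S ` fin_seqs m = fin_seqs m"
    by (simp add: bij_betw_def)
  moreover have "?U \<longleftrightarrow> (\<forall>p\<in>prime_factors m.
      card (reduced_support (primary_modulus m p) (primary_component m p S)) = 1)"
    using laurent_invertible_mod_iff[OF assms(1), of f]
      card_reduced_support_primary_component[OF assms(1) S] by simp
  ultimately show ?thesis by blast
qed

end
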